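(* Let $\lambda>-1/2$, $\lambda\neq1/2$, $z>0$, and let $(\gamma_n)_{n\ge1}$ be the coefficients of the three-term recurrence relation $xP_n(x)=P_{n+1}(x)+\gamma_nP_{n-1}(x)$ satisfied by the monic polynomials $(P_n)_{n\ge0}$ orthogonal with respect to the weight $(1-x^2)^{\lambda-1/2}e^{-zx^2}$ on $(-1,1)$, with $\gamma_0=0$. Then they satisfy the Laguerre-Freud equation $$\frac12=\left[z+\lambda+n+1-z\gamma_{n+2}-z\gamma_{n+1}\right]\gamma_{n+1}-\left[z+\lambda+n-1-z\gamma_n-z\gamma_{n-1}\right]\gamma_n,\qquad n\ge1.$$
   Context: The monic orthogonal polynomials satisfy $\deg P_n=n$ and $\int_{-1}^1P_nP_m(1-x^2)^{\lambda-1/2}e^{-zx^2}dx=0$ for $n\ne m$; since the weight is even, the recurrence has the stated form for $n\ge0$ with $P_{-1}=0$, $P_0=1$. *)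

theory Defs
  imports "HOL-Analysis.Analysis" "HOL-Computational_Algebra.Polynomial"
begin

definition gegenbauer_gauss_weight :: "real \<Rightarrow> real \<Rightarrow> real \<Rightarrow> real" where
  "gegenbauer_gauss_weight lam z x = (1 - x\<^sup>2) powr (lam - 1/2) * exp (- z * x\<^sup>2)"

definition monic_orthogonal_polys :: "(real \<Rightarrow> real) \<Rightarrow> (nat \<Rightarrow> real poly) \<Rightarrow> bool" where
  "monic_orthogonal_polys w P \<longleftrightarrow>
     (\<forall>n. degree (P n) = n \<and> lead_coeff (P n) = 1) \<and>
     (\<forall>n m. n \<noteq> m \<longrightarrow>
        (LINT x:{-1<..<1}|lborel. poly (P n) x * poly (P m) x * w x) = 0)"

text \<open>
  The recurrence \<open>x P\<^sub>n = P\<^sub>n\<^sub>+\<^sub>1 + \<gamma>\<^sub>n P\<^sub>n\<^sub>-\<^sub>1\<close> for \<open>n \<ge> 0\<close>, where \<open>P\<^sub>-\<^sub>1 = 0\<close>; the case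
  distinction is needed because \<open>0 - 1 = 0\<close> on the natural numbers. The value of \<open>\<gamma> 0\<close>
  is not constrained by it.
\<close>
definition symmetric_recurrence :: "(nat \<Rightarrow> real poly) \<Rightarrow> (nat \<Rightarrow> real) \<Rightarrow> bool" where
  "symmetric_recurrence P \<gamma> \<longleftrightarrow>
     (\<forall>n. [:0, 1:] * P n = P (n + 1) + smult (\<gamma> n) (if n = 0 then 0 else P (n - 1)))"

end

theory Submission
  imports Defs
begin

text \<open>
  The weight \<open>w\<close> satisfies the Pearson equation
  \<open>((1 - x\<^sup>2) w)' = - x (2 \<lambda> + 1 + 2 z - 2 z x\<^sup>2) w\<close>, and \<open>(1 - x\<^sup>2) w\<close> vanishes at \<open>-1\<close> and \<open>1\<close>,
  so integration by parts gives \<open>L ((1 - x\<^sup>2) p') = L (x (2 \<lambda> + 1 + 2 z - 2 z x\<^sup>2) p)\<close> for the moment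
  functional \<open>L\<close> and all polynomials \<open>p\<close>. For \<open>p = P\<^sub>m\<^sub>+\<^sub>1 P\<^sub>m\<close> this reads
  \<open>(m + 1) - (2 m + 1) \<gamma>\<^sub>m\<^sub>+\<^sub>1 - 2 (\<gamma>\<^sub>0 + \<dots> + \<gamma>\<^sub>m)
    = \<gamma>\<^sub>m\<^sub>+\<^sub>1 (2 \<lambda> + 1 + 2 z - 2 z (\<gamma>\<^sub>m + \<gamma>\<^sub>m\<^sub>+\<^sub>1 + \<gamma>\<^sub>m\<^sub>+\<^sub>2))\<close>;
  the difference of the cases \<open>m = n\<close> and \<open>m = n - 1\<close> eliminates the sum.
\<close>

section \<open>Symmetric orthogonal polynomials of a linear functional\<close>

text \<open>The algebra is done for an abstract linear functional with nonzero norms; the integral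
  enters only through the Pearson identity, a hypothesis of \<open>laguerre_freud\<close>.\<close>

locale symmetric_orthogonal_polys =
  fixes L :: "real poly \<Rightarrow> real" and P :: "nat \<Rightarrow> real poly" and \<gamma> :: "nat \<Rightarrow> real"
  assumes L_add: "L (p + q) = L p + L q"
    and L_smult: "L (smult c p) = c * L p"
    and degree_P: "degree (P n) = n"
    and monic_P: "lead_coeff (P n) = 1"
    and orthogonal: "n \<noteq> m \<Longrightarrow> L (P n * P m) = 0"
    and norm_nonzero: "L (P n * P n) \<noteq> 0"
    and recurrence: "symmetric_recurrence P \<gamma>"
    and gamma_0: "\<gamma> 0 = 0"
begin

definition h :: "nat \<Rightarrow> real" where
  "h n = L (P n * P n)"

lemma L_0 [simp]: "L 0 = 0"
  using L_smult[of 0 0] by simp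

lemma L_diff: "L (p - q) = L p - L q"
  using L_add[of "p - q" q] by simp

lemma coeff_P [simp]: "coeff (P n) n = 1"
  using monic_P[of n] degree_P[of n] by simp

lemma P_0: "P 0 = 1"
proof -
  obtain c where "P 0 = [:c:]" using degree_P[of 0] by (rule degree_eq_zeroE)
  then show ?thesis using coeff_P[of 0] by simp
qed

lemma x_P_Suc: "[:0, 1:] * P (Suc n) = P (n + 2) + smult (\<gamma> (Suc n)) (P n)"
  using recurrence[unfolded symmetric_recurrence_def, rule_format, of "Suc n"] by simp

lemma x_P_0: "[:0, 1:] * P 0 = P (Suc 0)"
  using recurrence[unfolded symmetric_recurrence_def, rule_format, of 0] by simp

text \<open>Monic polynomials of each degree form a triangular basis: subtracting a multiple of
  \<open>P (Suc k)\<close> removes the top coefficient of \<open>p\<close> and lowers the degree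
  bound.\<close>

lemma L_P_mult_lower:
  assumes "degree p \<le> k" "k < n"
  shows "L (P n * p) = 0"
  using assms
proof (induction k arbitrary: p)
  case 0
  then obtain c where "p = [:c:]" by (metis degree_eq_zeroE le_zero_eq)
  then have "P n * p = smult c (P n * P 0)" by (simp add: P_0)
  then show ?case using orthogonal[of n 0] 0 by (simp add: L_smult)
next
  case (Suc k)
  define q where "q = p - smult (coeff p (Suc k)) (P (Suc k))"
  have "degree q \<le> Suc k" unfolding q_def
    using Suc.prems by (intro degree_diff_le) (auto simp: degree_P)
  moreover have "coeff q (Suc k) = 0" by (simp add: q_def)
  ultimately have "degree q \<le> k"
    by (metis le_SucE degree_0 leading_coeff_0_iff zero_le)
  then have "L (P n * q) = 0" using Suc by simp
  moreover have "P n * p = P n * q + smult (coeff p (Suc k)) (P n * P (Suc k))"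
    by (simp add: q_def algebra_simps)
  ultimately show ?case using orthogonal[of n "Suc k"] Suc.prems by (simp add: L_add L_smult)
qed

text \<open>Only the component of \<open>p\<close> along \<open>P n\<close> survives, so pairings
  with \<open>P n\<close> reduce to reading off a top coefficient.\<close>

lemma L_P_mult:
  assumes "degree p \<le> n"
  shows "L (P n * p) = coeff p n * h n"
proof -
  define q where "q = p - smult (coeff p n) (P n)"
  have "degree q \<le> n" unfolding q_def
    using assms by (intro degree_diff_le) (auto simp: degree_P)
  moreover have "coeff q n = 0" by (simp add: q_def)
  \<comment> \<open>The zero polynomial is separate because its degree is 0, which is not below
    \<open>n\<close> when \<open>n = 0\<close>.\<close>
  ultimately have "q = 0 \<or> degree q < n"
    by (metis le_neq_implies_less leading_coeff_0_iff)
  then have "L (P n * q) = 0" using L_P_mult_lower[of q "degree q" n] by auto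
  moreover have "P n * p = P n * q + smult (coeff p n) (P n * P n)"
    by (simp add: q_def algebra_simps)
  ultimately show ?thesis by (simp add: L_add L_smult h_def)
qed

text \<open>Evaluate \<open>L (x P_(n+1) P_n)\<close> twice: \<open>x\<close> attached to
  \<open>P_(n+1)\<close> calls for the recurrence, \<open>x\<close> attached to \<open>P_n\<close>
  gives a monic polynomial of degree \<open>n + 1\<close>.\<close>

lemma h_Suc: "h (Suc n) = \<gamma> (Suc n) * h n"
proof -
  have "L ([:0, 1:] * P (Suc n) * P n) = \<gamma> (Suc n) * h n"
    unfolding x_P_Suc using orthogonal[of "n + 2" n]
    by (simp add: algebra_simps L_add L_smult h_def)
  moreover have "L (P (Suc n) * ([:0, 1:] * P n)) = h (Suc n)"
    by (subst L_P_mult) (auto simp: degree_P degree_pCons_eq_if split: if_splits)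
  ultimately show ?thesis by (simp add: algebra_simps)
qed

lemma h_nonzero: "h n \<noteq> 0"
  using norm_nonzero by (simp add: h_def)

section \<open>Products of neighbouring polynomials with powers of \<open>x\<close>\<close>

lemma L_P_Suc_P: "L ([:0, 1:] * (P (Suc n) * P n)) = h (Suc n)"
  unfolding mult.assoc[symmetric] x_P_Suc h_Suc using orthogonal[of "n + 2" n]
  by (simp add: algebra_simps L_add L_smult h_def)

lemma L_x2_P_P: "L ([:0, 1:] ^ 2 * (P (Suc n) * P (Suc n))) = (\<gamma> (n + 2) + \<gamma> (Suc n)) * h (Suc n)"
proof -
  have "[:0, 1:] ^ 2 * (P (Suc n) * P (Suc n)) = ([:0, 1:] * P (Suc n)) * ([:0, 1:] * P (Suc n))"
    by (simp add: power2_eq_square algebra_simps)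
  also have "\<dots> = P (n + 2) * P (n + 2) + smult (\<gamma> (Suc n)) (P (n + 2) * P n)
      + smult (\<gamma> (Suc n)) (P (n + 2) * P n) + smult ((\<gamma> (Suc n))\<^sup>2) (P n * P n)"
    unfolding x_P_Suc by (simp add: power2_eq_square algebra_simps)
  finally have "L ([:0, 1:] ^ 2 * (P (Suc n) * P (Suc n))) = h (n + 2) + (\<gamma> (Suc n))\<^sup>2 * h n"
    by (simp only: L_add L_smult) (simp add: orthogonal h_def)
  then show ?thesis using h_Suc[of "Suc n"] h_Suc[of n] by (simp add: power2_eq_square algebra_simps)
qed

lemma L_x3_P_Suc_P:
  "L ([:0, 1:] ^ 3 * (P (Suc n) * P n)) = (\<gamma> (n + 2) + \<gamma> (Suc n) + \<gamma> n) * h (Suc n)"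
proof (cases n)
  \<comment> \<open>Here the recurrence has no lower term; \<open>\<gamma> 0 = 0\<close> keeps the
    formula uniform.\<close>
  case 0
  have "[:0, 1:] ^ 3 * (P (Suc n) * P n) = [:0, 1:] ^ 2 * (P (Suc n) * ([:0, 1:] * P n))"
    by (simp add: power2_eq_square power3_eq_cube algebra_simps)
  also have "[:0, 1:] * P n = P (Suc n)"
    using x_P_0 0 by simp
  finally have "L ([:0, 1:] ^ 3 * (P (Suc n) * P n)) = (\<gamma> (n + 2) + \<gamma> (Suc n)) * h (Suc n)"
    by (simp only: L_x2_P_P)
  then show ?thesis using gamma_0 0 by simp
next
  case (Suc k)
  have "[:0, 1:] ^ 3 * (P (Suc n) * P n) = [:0, 1:] ^ 2 * P (Suc n) * ([:0, 1:] * P n)"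
    by (simp add: power2_eq_square power3_eq_cube algebra_simps)
  also have "[:0, 1:] * P n = P (Suc n) + smult (\<gamma> n) (P k)"
    using x_P_Suc[of k] Suc by simp
  also have "[:0, 1:] ^ 2 * P (Suc n) * (P (Suc n) + smult (\<gamma> n) (P k))
      = [:0, 1:] ^ 2 * (P (Suc n) * P (Suc n)) + smult (\<gamma> n) (P (Suc n) * ([:0, 1:] ^ 2 * P k))"
    by (simp add: algebra_simps)
  finally have "L ([:0, 1:] ^ 3 * (P (Suc n) * P n)) = (\<gamma> (n + 2) + \<gamma> (Suc n)) * h (Suc n)
      + \<gamma> n * L (P (Suc n) * ([:0, 1:] ^ 2 * P k))"
    by (simp only: L_add L_smult L_x2_P_P)
  \<comment> \<open>Since \<open>n = Suc k\<close>, the factor \<open>x^2 P_k\<close> is monic of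
    degree \<open>Suc n\<close>.\<close>
  moreover have "L (P (Suc n) * ([:0, 1:] ^ 2 * P k)) = h (Suc n)"
    by (subst L_P_mult) (auto simp: degree_P degree_pCons_eq_if Suc power2_eq_square split: if_splits)
  ultimately show ?thesis by (simp add: algebra_simps)
qed

section \<open>Products involving derivatives\<close>

lemma degree_pderiv_P: "degree (pderiv (P n)) = n - 1"
  by (simp add: degree_pderiv degree_P)

lemma L_pderiv_P_Suc_P: "L (pderiv (P (Suc n)) * P n) = real (Suc n) * h n"
  using L_P_mult[of "pderiv (P (Suc n))" n]
  by (simp add: degree_pderiv_P coeff_pderiv mult.commute)

lemma L_P_Suc_pderiv_P: "L (P (Suc n) * pderiv (P n)) = 0"
  by (rule L_P_mult_lower[of _ "n - 1"]) (auto simp: degree_pderiv_P)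

lemma L_x2_P_Suc_pderiv_P: "L ([:0, 1:] ^ 2 * (P (Suc n) * pderiv (P n))) = real n * h (Suc n)"
proof (cases n)
  case 0
  then show ?thesis by (simp add: P_0)
next
  case (Suc k)
  have "L (P (Suc n) * ([:0, 1:] ^ 2 * pderiv (P n))) = real n * h (Suc n)"
    by (subst L_P_mult) (auto simp: degree_pderiv_P degree_pCons_eq_if coeff_pderiv Suc power2_eq_square
        split: if_splits)
  then show ?thesis by (simp add: algebra_simps)
qed

text \<open>Differentiating the recurrence gives the induction step.\<close>

lemma L_x2_pderiv_P_Suc_P:
  "L ([:0, 1:] ^ 2 * (pderiv (P (Suc n)) * P n)) = real (Suc n) * h (Suc n) + 2 * (\<Sum>j\<le>n. \<gamma> j) * h n"
proof (induction n)
  case 0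
  have "[:0, 1:] ^ 2 * (pderiv (P (Suc 0)) * P 0) = P (Suc 0) * P (Suc 0)"
    unfolding x_P_0[symmetric] P_0 by (simp add: power2_eq_square pderiv_pCons)
  then show ?case using gamma_0 by (simp add: h_def)
next
  case (Suc n)
  let ?X = "[:0, 1::real:]"
  have "pderiv (?X * P (Suc n)) = pderiv (P (n + 2) + smult (\<gamma> (Suc n)) (P n))"
    by (simp only: x_P_Suc)
  then have d: "pderiv (P (n + 2)) = P (Suc n) + ?X * pderiv (P (Suc n)) - smult (\<gamma> (Suc n)) (pderiv (P n))"
    by (simp add: pderiv_mult pderiv_pCons pderiv_add pderiv_smult algebra_simps)
  have "?X * pderiv (P (n + 2)) * P n
      = ?X * (P (Suc n) * P n) + ?X ^ 2 * (pderiv (P (Suc n)) * P n)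
        - smult (\<gamma> (Suc n)) (?X * pderiv (P n) * P n)"
    unfolding d by (simp add: power2_eq_square algebra_simps)
  moreover have "L (?X * pderiv (P n) * P n) = real n * h n"
  proof (cases n)
    case (Suc k)
    have "L (P n * (?X * pderiv (P n))) = real n * h n"
      by (subst L_P_mult) (auto simp: degree_pderiv_P degree_pCons_eq_if coeff_pderiv Suc split: if_splits)
    then show ?thesis by (simp add: algebra_simps)
  qed (simp add: P_0)
  \<comment> \<open>The induction hypothesis supplies the middle term. With
    \<open>\<gamma> (Suc n) * h n = h (Suc n)\<close>, the multiples of \<open>h (Suc n)\<close> add
    up to \<open>1 + (n + 1) - n = 2\<close>.\<close>
  ultimately have D: "L (?X * pderiv (P (n + 2)) * P n)
      = 2 * h (Suc n) + 2 * (\<Sum>j\<le>n. \<gamma> j) * h n"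
    using Suc.IH L_P_Suc_P[of n] h_Suc[of n]
    by (simp only: L_add L_diff L_smult) (simp add: algebra_simps)
  \<comment> \<open>One factor \<open>x\<close> goes to \<open>P (Suc n)\<close>, where the
    recurrence yields a top-coefficient term and \<open>\<gamma> (Suc n)\<close> times
    \<open>D\<close>. The term \<open>2 * h (Suc n)\<close> of \<open>D\<close> then extends the sum
    by \<open>\<gamma> (Suc n)\<close>.\<close>
  have "?X ^ 2 * (pderiv (P (n + 2)) * P (Suc n)) = ?X * pderiv (P (n + 2)) * (?X * P (Suc n))"
    by (simp add: power2_eq_square algebra_simps)
  also have "\<dots> = P (n + 2) * (?X * pderiv (P (n + 2)))
      + smult (\<gamma> (Suc n)) (?X * pderiv (P (n + 2)) * P n)"
    unfolding x_P_Suc by (simp add: algebra_simps)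
  finally have "L (?X ^ 2 * (pderiv (P (n + 2)) * P (Suc n)))
      = L (P (n + 2) * (?X * pderiv (P (n + 2)))) + \<gamma> (Suc n) * L (?X * pderiv (P (n + 2)) * P n)"
    by (simp only: L_add L_smult)
  moreover have "L (P (n + 2) * (?X * pderiv (P (n + 2)))) = real (n + 2) * h (n + 2)"
    by (subst L_P_mult) (auto simp: degree_pderiv_P degree_pCons_eq_if coeff_pderiv split: if_splits)
  ultimately show ?case using D h_Suc[of n] by (simp add: algebra_simps)
qed

section \<open>From the Pearson identity to the Laguerre-Freud equation\<close>

lemma freud_sum_equation:
  assumes pearson: "\<And>p. L ([:1, 0, -1:] * pderiv p) = L ([:0, c, 0, - d:] * p)"
  shows "real (Suc n) - (2 * real n + 1) * \<gamma> (Suc n) - 2 * (\<Sum>j\<le>n. \<gamma> j)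
    = (c - d * (\<gamma> (n + 2) + \<gamma> (Suc n) + \<gamma> n)) * \<gamma> (Suc n)"
proof -
  let ?X = "[:0, 1::real:]"
  have "[:1, 0, -1:] * pderiv (P (Suc n) * P n)
      = pderiv (P (Suc n)) * P n + P (Suc n) * pderiv (P n)
        - ?X ^ 2 * (pderiv (P (Suc n)) * P n) - ?X ^ 2 * (P (Suc n) * pderiv (P n))"
  proof -
    have "[:1, 0, -1:] = 1 - ?X ^ 2" by (simp add: power2_eq_square one_pCons)
    then show ?thesis by (simp only: pderiv_mult) (simp only: algebra_simps)
  qed
  moreover have "[:0, c, 0, - d:] * (P (Suc n) * P n)
      = smult c (?X * (P (Suc n) * P n)) - smult d (?X ^ 3 * (P (Suc n) * P n))"
  proof -
    have "[:0, c, 0, - d:] = smult c ?X - smult d (?X ^ 3)" by (simp add: power3_eq_cube)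
    then show ?thesis by (simp only: left_diff_distrib mult_smult_left)
  qed
  ultimately have "real (Suc n) * h n - (real (Suc n) * h (Suc n) + 2 * (\<Sum>j\<le>n. \<gamma> j) * h n)
      - real n * h (Suc n) = c * h (Suc n) - d * ((\<gamma> (n + 2) + \<gamma> (Suc n) + \<gamma> n) * h (Suc n))"
    using pearson[of "P (Suc n) * P n"]
    by (simp only: L_add L_diff L_smult L_pderiv_P_Suc_P L_P_Suc_pderiv_P L_x2_pderiv_P_Suc_P
        L_x2_P_Suc_pderiv_P L_P_Suc_P L_x3_P_Suc_P)
  \<comment> \<open>Rewriting \<open>h (Suc n)\<close> by \<open>h_Suc\<close> leaves
    \<open>h n\<close> as a common nonzero factor.\<close>
  then have "(real (Suc n) - (2 * real n + 1) * \<gamma> (Suc n) - 2 * (\<Sum>j\<le>n. \<gamma> j)) * h n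
    = (c - d * (\<gamma> (n + 2) + \<gamma> (Suc n) + \<gamma> n)) * \<gamma> (Suc n) * h n"
    unfolding h_Suc by (simp add: algebra_simps)
  then show ?thesis using h_nonzero by simp
qed

lemma laguerre_freud:
  assumes pearson: "\<And>p. L ([:1, 0, -1:] * pderiv p) = L ([:0, 2 * lam + 1 + 2 * z, 0, - (2 * z):] * p)"
    and "n \<ge> 1"
  shows "1/2 = (z + lam + real n + 1 - z * \<gamma> (n + 2) - z * \<gamma> (n + 1)) * \<gamma> (n + 1)
             - (z + lam + real n - 1 - z * \<gamma> n - z * \<gamma> (n - 1)) * \<gamma> n"
proof -
  obtain k where k: "n = Suc k" using assms(2) by (cases n) auto
  show ?thesis
    \<comment> \<open>The sums differ by \<open>\<gamma> n\<close>, the products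
      \<open>\<gamma> n * \<gamma> (n + 1)\<close> cancel, and the difference is twice the
      claim.\<close>
    using freud_sum_equation[OF pearson, of k] freud_sum_equation[OF pearson, of n]
    unfolding k by (simp add: algebra_simps)
qed

end

section \<open>The moment functional of the weight\<close>

text \<open>The derivative may be unbounded at the endpoints, as happens for
  \<open>lam < 1/2\<close>; continuity of \<open>F\<close> supplies the boundary limits.\<close>

lemma set_integral_FTC_open_interval:
  fixes F f :: "real \<Rightarrow> real"
  assumes "a < b" "continuous_on {a..b} F"
    and "\<And>x. x \<in> {a<..<b} \<Longrightarrow> (F has_real_derivative f x) (at x)"
    and "\<And>x. x \<in> {a<..<b} \<Longrightarrow> isCont f x"
    and "set_integrable lborel {a<..<b} f"
  shows "(LINT x:{a<..<b}|lborel. f x) = F b - F a"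
proof -
  have "(LBINT x=ereal a..ereal b. f x) = F b - F a"
    using assms
    by (intro interval_integral_FTC_integrable)
      (auto simp: has_real_derivative_iff_has_vector_derivative ereal_tendsto_simps
        continuous_on_Icc_at_rightD continuous_on_Icc_at_leftD)
  then show ?thesis using assms(1) by (simp add: interval_lebesgue_integral_le_eq)
qed

lemma set_integrable_nonneg_derivative:
  fixes F f :: "real \<Rightarrow> real"
  assumes "a < b" "continuous_on {a..b} F"
    and "\<And>x. x \<in> {a<..<b} \<Longrightarrow> (F has_real_derivative f x) (at x)"
    and "\<And>x. x \<in> {a<..<b} \<Longrightarrow> isCont f x"
    and "\<And>x. x \<in> {a<..<b} \<Longrightarrow> f x \<ge> 0"
  shows "set_integrable lborel {a<..<b} f"
proof -
  have "set_integrable lborel (einterval (ereal a) (ereal b)) f"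
    using assms
    by (intro interval_integral_FTC_nonneg(1)[where F = F and A = "F a" and B = "F b"])
      (auto simp: ereal_tendsto_simps continuous_on_Icc_at_rightD continuous_on_Icc_at_leftD)
  then show ?thesis by simp
qed

text \<open>Since \<open>1 - x^2\<close> lies between \<open>1 - |x|\<close> and
  \<open>1 + |x|\<close>, its power is dominated by the sum of the powers of \<open>1 + x\<close>
  and \<open>1 - x\<close>, whatever the sign of \<open>s\<close>.\<close>

lemma set_integrable_one_minus_square_powr:
  fixes s :: real
  assumes "s > - 1"
  shows "set_integrable lborel {-1<..<1} (\<lambda>x. (1 - x\<^sup>2) powr s)"
proof (rule set_integrable_bound)
  show "set_integrable lborel {-1<..<1} (\<lambda>x::real. (1 + x) powr s + (1 - x) powr s)"
  proof (rule set_integrable_nonneg_derivative)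
    \<comment> \<open>This primitive extends continuously to the endpoints because
      \<open>s + 1 > 0\<close>.\<close>
    let ?F = "\<lambda>x::real. ((1 + x) powr (s + 1) - (1 - x) powr (s + 1)) / (s + 1)"
    show "continuous_on {-1..1} ?F"
      using assms by (intro continuous_intros continuous_on_powr') auto
    fix x :: real assume x: "x \<in> {-1<..<1}"
    show "(?F has_real_derivative (1 + x) powr s + (1 - x) powr s) (at x)"
    proof -
      have "((\<lambda>x. (1 + x) powr (s + 1)) has_real_derivative (s + 1) * (1 + x) powr s) (at x)"
        using DERIV_fun_powr[OF DERIV_add[OF DERIV_const DERIV_ident], of 1 x "s + 1"] x by simp
      moreover have "((\<lambda>x. (1 - x) powr (s + 1)) has_real_derivative - ((s + 1) * (1 - x) powr s)) (at x)"
        using DERIV_fun_powr[OF DERIV_diff[OF DERIV_const DERIV_ident], of 1 x "s + 1"] x by simp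
      ultimately show ?thesis
        by (rule DERIV_cong[OF DERIV_cdivide[OF DERIV_diff]])
          (use assms in \<open>simp add: field_simps\<close>)
    qed
    show "isCont (\<lambda>x. (1 + x) powr s + (1 - x) powr s) x"
      using x by (intro continuous_intros) auto
  qed auto
  show "set_borel_measurable lborel {-1<..<1} (\<lambda>x. (1 - x\<^sup>2) powr s)"
    unfolding set_borel_measurable_def by measurable
  have "(1 - x\<^sup>2) powr s \<le> (1 + x) powr s + (1 - x) powr s" if x: "x \<in> {-1<..<1}" for x :: real
  proof -
    have "\<bar>x\<bar> < 1" using x by auto
    then have "\<bar>x\<bar> * \<bar>x\<bar> \<le> \<bar>x\<bar> * 1"
      by (intro mult_left_mono) auto
    then have "x\<^sup>2 \<le> \<bar>x\<bar>" by (simp add: power2_eq_square)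
    then have le: "1 - \<bar>x\<bar> \<le> 1 - x\<^sup>2" "1 - x\<^sup>2 \<le> 1 + \<bar>x\<bar>" "0 < 1 - \<bar>x\<bar>"
      using \<open>\<bar>x\<bar> < 1\<close> zero_le_power2[of x] by linarith+
    have "(1 - x\<^sup>2) powr s \<le> (1 + \<bar>x\<bar>) powr s + (1 - \<bar>x\<bar>) powr s"
    proof (cases "s \<ge> 0")
      case True
      then show ?thesis using powr_mono2[of s "1 - x\<^sup>2" "1 + \<bar>x\<bar>"] le by (smt (verit) powr_ge_zero)
    next
      case False
      then show ?thesis using powr_mono2'[of s "1 - \<bar>x\<bar>" "1 - x\<^sup>2"] le by (smt (verit) powr_ge_zero)
    qed
    then show ?thesis by (auto simp: abs_if split: if_splits)
  qed
  then show "AE x in lborel. x \<in> {-1<..<1} \<longrightarrow>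
      norm ((1 - x\<^sup>2) powr s) \<le> norm ((1 + x) powr s + (1 - x) powr s)"
    by (intro AE_I2) auto
qed

text \<open>The polynomial and the exponential are bounded on the closed interval, so the power of
  \<open>1 - x^2\<close> dominates up to a constant.\<close>

lemma set_integrable_poly_weight:
  assumes "lam > - 1/2"
  shows "set_integrable lborel {-1<..<1} (\<lambda>x. poly p x * gegenbauer_gauss_weight lam z x)"
proof -
  have "bounded ((\<lambda>x. poly p x * exp (- z * x\<^sup>2)) ` {-1..1})"
    by (intro compact_imp_bounded compact_continuous_image continuous_intros) auto
  then obtain B where B: "\<forall>x\<in>{-1..1}. \<bar>poly p x * exp (- z * x\<^sup>2)\<bar> \<le> B"
    by (auto simp: bounded_iff)
  show ?thesis
  proof (rule set_integrable_bound)
    show "set_integrable lborel {-1<..<1} (\<lambda>x. B * (1 - x\<^sup>2) powr (lam - 1/2))"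
      using assms by (intro set_integrable_mult_right set_integrable_one_minus_square_powr) auto
    show "set_borel_measurable lborel {-1<..<1} (\<lambda>x. poly p x * gegenbauer_gauss_weight lam z x)"
      unfolding set_borel_measurable_def gegenbauer_gauss_weight_def
      by (measurable, auto intro!: borel_measurable_continuous_onI continuous_intros)
    have "\<bar>poly p x * gegenbauer_gauss_weight lam z x\<bar> \<le> B * (1 - x\<^sup>2) powr (lam - 1/2)"
      if x: "x \<in> {-1<..<1}" for x
      using mult_right_mono[OF bspec[OF B, of x], of "(1 - x\<^sup>2) powr (lam - 1/2)"] x
      by (simp add: gegenbauer_gauss_weight_def abs_mult mult_ac)
    then show "AE x in lborel. x \<in> {-1<..<1} \<longrightarrow>
        norm (poly p x * gegenbauer_gauss_weight lam z x) \<le> norm (B * (1 - x\<^sup>2) powr (lam - 1/2))"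
      by (intro AE_I2) (fastforce intro: order_trans[OF _ abs_ge_self])
  qed
qed

section \<open>Linearity, definiteness and Pearson identity of the functional\<close>

definition weight_functional :: "real \<Rightarrow> real \<Rightarrow> real poly \<Rightarrow> real" where
  "weight_functional lam z p = (LINT x:{-1<..<1}|lborel. poly p x * gegenbauer_gauss_weight lam z x)"

lemma weight_functional_add:
  assumes "lam > - 1/2"
  shows "weight_functional lam z (p + q) = weight_functional lam z p + weight_functional lam z q"
  unfolding weight_functional_def poly_add distrib_right
  using assms by (intro set_integral_add set_integrable_poly_weight)

lemma weight_functional_smult: "weight_functional lam z (smult c p) = c * weight_functional lam z p"
  unfolding weight_functional_def by (simp add: mult.assoc)

text \<open>A nonnegative integrand with zero integral vanishes almost everywhere, but this one is
  positive on the interval off the finitely many roots of \<open>p\<close>; the interval would be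
  null.\<close>

lemma weight_functional_square_nonzero:
  assumes "lam > - 1/2" "p \<noteq> 0"
  shows "weight_functional lam z (p * p) \<noteq> 0"
proof
  let ?f = "\<lambda>x. indicator {-1<..<1} x *\<^sub>R (poly (p * p) x * gegenbauer_gauss_weight lam z x)"
  assume "weight_functional lam z (p * p) = 0"
  then have "integral\<^sup>L lborel ?f = 0"
    by (simp add: weight_functional_def set_lebesgue_integral_def)
  moreover have "integrable lborel ?f"
    using set_integrable_poly_weight[OF assms(1)] unfolding set_integrable_def .
  moreover have "AE x in lborel. 0 \<le> ?f x"
    by (intro AE_I2) (auto simp: gegenbauer_gauss_weight_def)
  ultimately have "AE x in lborel. ?f x = 0"
    using integral_nonneg_eq_0_iff_AE by blast
  moreover have "AE x in lborel. x \<notin> {x. poly p x = 0}"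
    using poly_roots_finite[OF assms(2)]
    by (intro AE_not_in finite_imp_null_set_lborel)
  ultimately have "AE x in lborel. x \<notin> {-1<..<1::real}"
  proof eventually_elim
    case (elim x)
    have "x\<^sup>2 < 1" if "x \<in> {-1<..<1}" using that by (simp add: abs_square_less_1 abs_if)
    then show ?case using elim by (auto simp: gegenbauer_gauss_weight_def indicator_def)
  qed
  then have "{-1<..<1::real} \<in> null_sets lborel"
    using AE_iff_null_sets[of "{-1<..<1::real}" lborel] by simp
  then show False by (simp add: null_sets_def)
qed

lemma weight_functional_pearson:
  assumes "lam > - 1/2"
  shows "weight_functional lam z ([:1, 0, -1:] * pderiv p)
    = weight_functional lam z ([:0, 2 * lam + 1 + 2 * z, 0, - (2 * z):] * p)"
proof -
  \<comment> \<open>\<open>?q\<close> is the difference of the two sides, written as a sum so that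
    additivity splits it. \<open>?F\<close> is \<open>p (1 - x^2) w\<close>, whose derivative is
    \<open>?q w\<close>.\<close>
  let ?q = "[:1, 0, -1:] * pderiv p + smult (-1) ([:0, 2 * lam + 1 + 2 * z, 0, - (2 * z):] * p)"
  let ?F = "\<lambda>x. poly p x * (1 - x\<^sup>2) powr (lam + 1/2) * exp (- z * x\<^sup>2)"
  have "weight_functional lam z ?q = ?F 1 - ?F (-1)"
    unfolding weight_functional_def
  proof (rule set_integral_FTC_open_interval)
    show "continuous_on {-1..1} ?F"
      using assms by (intro continuous_intros continuous_on_powr') (auto simp: abs_square_le_1)
    show "set_integrable lborel {-1<..<1} (\<lambda>x. poly ?q x * gegenbauer_gauss_weight lam z x)"
      by (rule set_integrable_poly_weight[OF assms])
    fix x :: real assume "x \<in> {-1<..<1}"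
    then have pos: "1 - x\<^sup>2 > 0" by (simp add: abs_square_less_1 abs_if)
    \<comment> \<open>Splitting off \<open>1 - x^2\<close> lets every term of the product rule carry
      the factor \<open>w\<close>.\<close>
    then have powr: "(1 - x\<^sup>2) powr (lam + 1/2) = (1 - x\<^sup>2) * (1 - x\<^sup>2) powr (lam - 1/2)"
      using powr_add[of "1 - x\<^sup>2" 1 "lam - 1/2"] by (simp add: add.commute)
    have "((\<lambda>x. (1 - x\<^sup>2) powr (lam + 1/2)) has_real_derivative
        (lam + 1/2) * (1 - x\<^sup>2) powr (lam - 1/2) * (- 2 * x)) (at x)"
      using pos by (auto intro!: derivative_eq_intros simp: powr field_simps)
    then show "(?F has_real_derivative poly ?q x * gegenbauer_gauss_weight lam z x) (at x)"
      by (rule DERIV_cong[OF DERIV_mult[OF DERIV_mult[OF poly_DERIV]]])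
        (auto intro!: derivative_eq_intros
          simp: powr[unfolded power2_eq_square] gegenbauer_gauss_weight_def power2_eq_square algebra_simps)
    show "isCont (\<lambda>x. poly ?q x * gegenbauer_gauss_weight lam z x) x"
      unfolding gegenbauer_gauss_weight_def using pos by (intro continuous_intros) auto
  qed simp
  \<comment> \<open>Both boundary values contain \<open>0 powr (lam + 1/2) = 0\<close>.\<close>
  also have "\<dots> = 0" by simp
  finally show ?thesis
    unfolding weight_functional_add[OF assms] weight_functional_smult by simp
qed

theorem proposition4p1:
  fixes lam z :: real and P :: "nat \<Rightarrow> real poly" and \<gamma> :: "nat \<Rightarrow> real" and n :: nat
  assumes "lam > - 1/2" and "lam \<noteq> 1/2" and "z > 0"
    and "monic_orthogonal_polys (gegenbauer_gauss_weight lam z) P"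
    and "symmetric_recurrence P \<gamma>"
    and "\<gamma> 0 = 0"
    and "n \<ge> 1"
  shows "1/2 = (z + lam + real n + 1 - z * \<gamma> (n + 2) - z * \<gamma> (n + 1)) * \<gamma> (n + 1)
             - (z + lam + real n - 1 - z * \<gamma> n - z * \<gamma> (n - 1)) * \<gamma> n"
proof -
  have P: "degree (P n) = n" "lead_coeff (P n) = 1" "P n \<noteq> 0" for n
    using assms(4) unfolding monic_orthogonal_polys_def by (auto dest: spec[of _ n])
  have orth: "weight_functional lam z (P n * P m) = 0" if "n \<noteq> m" for n m
    using assms(4) that unfolding monic_orthogonal_polys_def weight_functional_def by simp
  interpret symmetric_orthogonal_polys "weight_functional lam z" P \<gamma>
    using P assms(1,5,6)
    by unfold_locales (auto simp: weight_functional_add weight_functional_smult orth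
        weight_functional_square_nonzero)
  show ?thesis
    using assms(1,7) by (intro laguerre_freud weight_functional_pearson)
qed

end
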